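(* Let $(l^n_i)_{n\in\mathbb N,i\in\mathbb N_0}$, $\mathcal L$, $(f^n)_{n\in\mathbb N}$, $f$ and the binary shift $(X_f,\sigma)$ be as in the context. Then $(X_f,\sigma)$ is backward tame. Further, $(X_f,\sigma)$ is forward tame if and only if the $\mathbb N$-action $(X_{\mathcal L},\sigma)$ is tame.
   Context: **Tameness.** A binary shift $X\subseteq\{a,b\}^{\mathbb Z}$ ($\sigma(x)_n=x_{n+1}$) is *forward non-tame* (resp. *backward non-tame* ) if there is a sequence $(s_n)_{n\in\mathbb N}$ of positive (resp. negative) integers such that for every $\varphi\in\{a,b\}^{\mathbb N}$ there is $x\in X$ with $x_{s_n}=\varphi(n)$ for all $n$; otherwise it is forward (resp. backward) tame. A closed shift-invariant $Y\subseteq\{a,b\}^{\mathbb N}$ (an $\mathbb N$-action) is non-tame if there is a sequence $(\nu_n)$ in $\mathbb N$ such that for every $\varphi\in\{a,b\}^{\mathbb N}$ there is $y\in Y$ with $y_{\nu_n}=\varphi(n)$ for all $n$; otherwise tame. **Data.** $(l^n_i)_{n\in\mathbb N,i\in\mathbb N_0}\subset\mathbb N_0$ satisfies: (R1) $(l^n_0)_{n}$ is strictly increasing; (R2) for each $n$, $(l^n_i)_i$ is strictly increasing; (R3) for each $n$ there is $i_n\in\mathbb N_0$ with $l^n_{i+i_n}=l^{n+1}_{2i}$ for all $i\in\mathbb N_0$. $\mathcal L=\bigcup_n\mathcal L^n$, $\mathcal L^n=\mathcal L\cap\{a,b\}^n$, is a language over $\{a,b\}$ (closed under taking subwords) with $\mathcal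 L^1=\{a,b\}$ which is right-extendable: every $w\in\mathcal L^n$ has an extension $wc\in\mathcal L^{n+1}$, $c\in\{a,b\}$. $X_{\mathcal L}\subseteq\{a,b\}^{\mathbb N}$ is the set of one-sided sequences all of whose finite subwords lie in $\mathcal L$, with the left shift $\sigma$. $(f^n)_{n\in\mathbb N}$ is a family of functions $f^n:\mathbb N_0\to\{a,b\}$ such that for every $N\in\mathbb N$: (1) for each $i\in\mathbb N_0$ the map $x\mapsto f^1(x)f^2(x)\cdots f^N(x)$ is constant on $\{l^N_i,\dots,l^N_{i+1}-1\}$ with value a word $w^{(N,i)}\in\mathcal L^N$; (2) for every $w\in\mathcal L^N$ and $i_0\in\mathbb N$ there is $i\ge i_0$ with $w=w^{(N,i)}$. (Such families exist.) **The shift.** Let $\mathbb Z_2$ be the 2-adic integers and $t_n=2^{l^n_0}$. For $z\ne z'$ in $\mathbb Z_2$ let $L(z,z')$ be the number of common initial binary digits, i.e. the largest $i\geq 0$ with $z\equiv z' \bmod 2^i$. Let $U_n=\{z\in\mathbb Z_2: z\equiv t_n\bmod 2^{l^n_0+1}\}$; these sets are pairwise disjoint. Let $D=\{t_n:n\in\mathbb N\}\cup\{0\}$ and define $f:\mathbb Z_2\setminus D\to\{a,b\}$ by $f(z)=f^n(L(z,t_n))$ if $z\in U_n$, and $f(z)=a$ if $z\notin\bigcup_nU_n$. Fix $\hat z\in\mathbb Z_2\setminus\mathbb Z$ and let $X_f\subseteq\{a,b\}^{\mathbb Z}$ be the shift-orbit closure of $(f(\hat z+n))_{n\in\mathbb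 Z}$. It is an almost automorphic extension of the odometer $(\mathbb Z_2,+1)$. *)

theory Defs
  imports "HOL-Analysis.Function_Topology" "HOL-Library.Sublist"
begin

section \<open>The 2-adic integers\<close>

text \<open>
  The inverse limit of the rings Z/2^n: a 2-adic integer is the coherent sequence of its
  residues modulo 2^n, each represented in {0..<2^n}.
\<close>

typedef padic2 = "{x :: nat \<Rightarrow> int. \<forall>n. x n = x (Suc n) mod 2 ^ n}"
  morphisms residue2 Abs_padic2
  by (rule exI[of _ "\<lambda>_. 0"]) simp

setup_lifting type_definition_padic2

lemma residue2_Suc: "residue2 z (Suc n) mod 2 ^ n = residue2 z n"
  using residue2[of z] by (metis (mono_tags, lifting) mem_Collect_eq)

lemma residue2_mod_self [simp]: "residue2 z n mod 2 ^ n = residue2 z n"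
  by (metis residue2_Suc mod_mod_trivial)

lemma residue2_0 [simp]: "residue2 z 0 = 0"
  using residue2_mod_self[of z 0] by (simp del: residue2_mod_self)

lemma padic2_eqI: "(\<And>n. residue2 x n = residue2 y n) \<Longrightarrow> x = y"
  by (simp add: residue2_inject[symmetric] fun_eq_iff)

lemma residue2_mod: "m \<le> n \<Longrightarrow> residue2 z n mod 2 ^ m = residue2 z m"
proof (induction n rule: dec_induct)
  case (step n)
  have "residue2 z (Suc n) mod 2 ^ m = (residue2 z (Suc n) mod 2 ^ n) mod 2 ^ m"
    using step.hyps by (simp add: mod_mod_cancel le_imp_power_dvd)
  then show ?case
    using step.IH by (simp add: residue2_Suc)
qed simp

lemma coherent_int_mod: "(k :: int) mod 2 ^ n = k mod 2 ^ Suc n mod 2 ^ n"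
  by (simp add: mod_mod_cancel le_imp_power_dvd)

instantiation padic2 :: comm_ring_1
begin

lift_definition zero_padic2 :: padic2 is "\<lambda>_. 0" by simp

lift_definition one_padic2 :: padic2 is "\<lambda>n. 1 mod 2 ^ n"
  using coherent_int_mod by blast

lift_definition plus_padic2 :: "padic2 \<Rightarrow> padic2 \<Rightarrow> padic2"
  is "\<lambda>x y n. (x n + y n) mod 2 ^ n"
  by (metis coherent_int_mod mod_add_eq)

lift_definition uminus_padic2 :: "padic2 \<Rightarrow> padic2" is "\<lambda>x n. (- x n) mod 2 ^ n"
  by (metis coherent_int_mod mod_minus_eq)

lift_definition minus_padic2 :: "padic2 \<Rightarrow> padic2 \<Rightarrow> padic2"
  is "\<lambda>x y n. (x n - y n) mod 2 ^ n"
  by (metis coherent_int_mod mod_diff_eq)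

lift_definition times_padic2 :: "padic2 \<Rightarrow> padic2 \<Rightarrow> padic2"
  is "\<lambda>x y n. (x n * y n) mod 2 ^ n"
  by (metis coherent_int_mod mod_mult_eq)

instance
proof
  fix a b c :: padic2
  note eqs = zero_padic2.rep_eq one_padic2.rep_eq plus_padic2.rep_eq uminus_padic2.rep_eq
    minus_padic2.rep_eq times_padic2.rep_eq
  show "a * b * c = a * (b * c)"
    by (rule padic2_eqI) (simp add: eqs mod_simps mult.assoc)
  show "a * b = b * a"
    by (rule padic2_eqI) (simp add: eqs mult.commute)
  show "1 * a = a"
    by (rule padic2_eqI) (simp add: eqs mod_simps)
  show "a + b + c = a + (b + c)"
    by (rule padic2_eqI) (simp add: eqs mod_simps add.assoc)
  show "a + b = b + a"
    by (rule padic2_eqI) (simp add: eqs add.commute)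
  show "0 + a = a"
    by (rule padic2_eqI) (simp add: eqs)
  show "- a + a = 0"
    by (rule padic2_eqI) (simp add: eqs mod_simps)
  show "a - b = a + - b"
    by (rule padic2_eqI) (simp add: eqs mod_simps)
  show "(a + b) * c = a * c + b * c"
    by (rule padic2_eqI) (simp add: eqs mod_simps distrib_right)
  have "residue2 0 1 \<noteq> residue2 1 1" by (simp add: eqs)
  then show "(0 :: padic2) \<noteq> 1" by metis
qed

end

lemma residue2_of_int: "residue2 (of_int k) n = k mod 2 ^ n"
proof -
  have nat: "residue2 (of_nat m) n = int m mod 2 ^ n" for m
    by (induction m) (auto simp: zero_padic2.rep_eq one_padic2.rep_eq plus_padic2.rep_eq mod_simps)
  show ?thesis
    by (cases k rule: int_cases2) (auto simp: nat uminus_padic2.rep_eq mod_simps)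
qed

lemma residue2_two_power: "residue2 (2 ^ i) n = 2 ^ i mod 2 ^ n"
  using residue2_of_int[of "2 ^ i" n] by simp

text \<open>
  Divisibility by 2^i in the ring is agreement modulo 2^i, that is, agreement of the first i
  binary digits.
\<close>

lemma two_power_dvd_diff_iff:
  "2 ^ i dvd z - z' \<longleftrightarrow> residue2 z i = residue2 z' i"
proof
  assume "2 ^ i dvd z - z'"
  then obtain k where k: "z - z' = 2 ^ i * k" by blast
  have "residue2 (z - z') i = 0"
    by (simp add: k times_padic2.rep_eq residue2_two_power mod_simps)
  then have "residue2 z i mod 2 ^ i = residue2 z' i mod 2 ^ i"
    by (simp add: minus_padic2.rep_eq mod_eq_dvd_iff mod_0_imp_dvd del: residue2_mod_self)
  then show "residue2 z i = residue2 z' i" by simp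
next
  assume eq: "residue2 z i = residue2 z' i"
  define d where "d = z - z'"
  have d0: "residue2 d i = 0"
    by (simp add: d_def minus_padic2.rep_eq eq)
  define q where "q n = residue2 d (n + i) div 2 ^ i" for n
  have mul: "residue2 d (n + i) = 2 ^ i * q n" for n
    using residue2_mod[of i "n + i" d] d0 unfolding q_def by (auto simp: mod_0_imp_dvd)
  have "q n = q (Suc n) mod 2 ^ n" for n
  proof -
    have "2 ^ i * q n = (2 ^ i * q (Suc n)) mod (2 ^ i * 2 ^ n)"
      using residue2_Suc[of d "n + i"] mul[of n] mul[of "Suc n"]
      by (simp add: power_add mult.commute)
    then show ?thesis by (simp flip: mult_mod_right)
  qed
  then have q: "residue2 (Abs_padic2 q) = q" by (intro Abs_padic2_inverse CollectI allI)
  have "residue2 d n = residue2 (2 ^ i * Abs_padic2 q) n" for n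
    using residue2_mod[of n "n + i" d] mul[of n]
    by (simp add: times_padic2.rep_eq residue2_two_power q mod_simps)
  then have "d = 2 ^ i * Abs_padic2 q" by (rule padic2_eqI)
  then show "2 ^ i dvd z - z'" by (simp add: d_def)
qed

text \<open>Only used for distinct arguments, where the greatest element exists (see below).\<close>

definition common_digits :: "padic2 \<Rightarrow> padic2 \<Rightarrow> nat" where
  "common_digits z z' = (GREATEST i. 2 ^ i dvd z - z')"

lemma common_digits_iff:
  assumes "z \<noteq> z'"
  shows "i \<le> common_digits z z' \<longleftrightarrow> 2 ^ i dvd z - z'"
proof -
  obtain m where m: "\<not> 2 ^ m dvd z - z'"
    using assms by (metis two_power_dvd_diff_iff padic2_eqI)
  have bound: "j \<le> m" if "2 ^ j dvd z - z'" for j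
    using that m by (meson dvd_trans le_imp_power_dvd nat_le_linear)
  have "2 ^ common_digits z z' dvd z - z'"
    unfolding common_digits_def by (rule GreatestI_nat[where k = 0 and b = m]) (auto intro: bound)
  moreover have "j \<le> common_digits z z'" if "2 ^ j dvd z - z'" for j
    unfolding common_digits_def by (rule Greatest_le_nat[where b = m]) (auto intro: bound that)
  ultimately show ?thesis by (meson dvd_trans le_imp_power_dvd)
qed


section \<open>Binary shifts and tameness\<close>

datatype letter = Letter_a | Letter_b

text \<open>
  A point of {a,b}^N is a function on all of nat: the coordinates 1, 2, 3, ... are renamed to
  0, 1, 2, ... .  Likewise the sequences of positions and the patterns are indexed from 0.
\<close>

definition forward_nontame :: "(int \<Rightarrow> letter) set \<Rightarrow> bool" where
  "forward_nontame X \<longleftrightarrow>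
     (\<exists>s :: nat \<Rightarrow> int. (\<forall>n. 0 < s n) \<and>
        (\<forall>\<phi> :: nat \<Rightarrow> letter. \<exists>x\<in>X. \<forall>n. x (s n) = \<phi> n))"

definition backward_nontame :: "(int \<Rightarrow> letter) set \<Rightarrow> bool" where
  "backward_nontame X \<longleftrightarrow>
     (\<exists>s :: nat \<Rightarrow> int. (\<forall>n. s n < 0) \<and>
        (\<forall>\<phi> :: nat \<Rightarrow> letter. \<exists>x\<in>X. \<forall>n. x (s n) = \<phi> n))"

abbreviation forward_tame :: "(int \<Rightarrow> letter) set \<Rightarrow> bool" where
  "forward_tame X \<equiv> \<not> forward_nontame X"

abbreviation backward_tame :: "(int \<Rightarrow> letter) set \<Rightarrow> bool" where
  "backward_tame X \<equiv> \<not> backward_nontame X"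

definition one_sided_nontame :: "(nat \<Rightarrow> letter) set \<Rightarrow> bool" where
  "one_sided_nontame Y \<longleftrightarrow>
     (\<exists>\<nu> :: nat \<Rightarrow> nat. \<forall>\<phi> :: nat \<Rightarrow> letter. \<exists>y\<in>Y. \<forall>n. y (\<nu> n) = \<phi> n)"

abbreviation one_sided_tame :: "(nat \<Rightarrow> letter) set \<Rightarrow> bool" where
  "one_sided_tame Y \<equiv> \<not> one_sided_nontame Y"

definition orbit_closure :: "(int \<Rightarrow> letter) \<Rightarrow> (int \<Rightarrow> letter) set" where
  "orbit_closure x =
     product_topology (\<lambda>_. discrete_topology UNIV) UNIV closure_of
       range (\<lambda>k :: int. (\<lambda>n. x (n + k)))"


section \<open>The data\<close>

text \<open>
  The families \<open>l n\<close> and \<open>f n\<close> are indexed by n = 1, 2, ...; their members at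
  index 0 are irrelevant and unconstrained.
\<close>

definition admissible_levels :: "(nat \<Rightarrow> nat \<Rightarrow> nat) \<Rightarrow> bool" where
  "admissible_levels l \<longleftrightarrow>
     strict_mono_on {1..} (\<lambda>n. l n 0) \<and>
     (\<forall>n\<ge>1. strict_mono (l n)) \<and>
     (\<forall>n\<ge>1. \<exists>k. \<forall>i. l n (i + k) = l (Suc n) (2 * i))"

text \<open>
  Only nonempty words matter; whether the empty word is counted as a member is left open.
\<close>

definition right_extendable_language :: "letter list set \<Rightarrow> bool" where
  "right_extendable_language \<L> \<longleftrightarrow>
     (\<forall>w\<in>\<L>. \<forall>u. sublist u w \<and> u \<noteq> [] \<longrightarrow> u \<in> \<L>) \<and>
     (\<forall>c. [c] \<in> \<L>) \<and>
     (\<forall>w\<in>\<L>. w \<noteq> [] \<longrightarrow> (\<exists>c. w @ [c] \<in> \<L>))"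

definition language_shift :: "letter list set \<Rightarrow> (nat \<Rightarrow> letter) set" where
  "language_shift \<L> = {y. \<forall>i j. i < j \<longrightarrow> map y [i..<j] \<in> \<L>}"

definition column_word :: "(nat \<Rightarrow> nat \<Rightarrow> letter) \<Rightarrow> nat \<Rightarrow> nat \<Rightarrow> letter list" where
  "column_word f N x = map (\<lambda>n. f n x) [1..<Suc N]"

text \<open>The word w^(N,i) is the value of the column word at the left end point of the i-th block.\<close>

definition adapted_family ::
  "(nat \<Rightarrow> nat \<Rightarrow> nat) \<Rightarrow> letter list set \<Rightarrow> (nat \<Rightarrow> nat \<Rightarrow> letter) \<Rightarrow> bool" where
  "adapted_family l \<L> f \<longleftrightarrow>
     (\<forall>N\<ge>1.
        (\<forall>i. column_word f N (l N i) \<in> \<L> \<and>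
             (\<forall>x\<in>{l N i..<l N (Suc i)}. column_word f N x = column_word f N (l N i))) \<and>
        (\<forall>w\<in>\<L>. length w = N \<longrightarrow> (\<forall>i0. \<exists>i\<ge>i0. w = column_word f N (l N i))))"

definition t_point :: "(nat \<Rightarrow> nat \<Rightarrow> nat) \<Rightarrow> nat \<Rightarrow> padic2" where
  "t_point l n = 2 ^ l n 0"

definition U_set :: "(nat \<Rightarrow> nat \<Rightarrow> nat) \<Rightarrow> nat \<Rightarrow> padic2 set" where
  "U_set l n = {z. 2 ^ (l n 0 + 1) dvd z - t_point l n}"

lemma residue2_U_set:
  assumes "z \<in> U_set l n"
  shows "residue2 z (Suc (l n 0)) = 2 ^ l n 0"
  using assms by (simp add: U_set_def t_point_def two_power_dvd_diff_iff residue2_two_power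
      del: power_Suc)

lemma U_set_disjoint:
  assumes "admissible_levels l" "1 \<le> m" "1 \<le> n" "z \<in> U_set l m" "z \<in> U_set l n"
  shows "m = n"
proof -
  have False if "z \<in> U_set l p" "z \<in> U_set l q" "l p 0 < l q 0" for p q
  proof -
    have "residue2 z (Suc (l p 0)) = residue2 z (Suc (l q 0)) mod 2 ^ Suc (l p 0)"
      using that(3) by (simp add: residue2_mod del: power_Suc)
    moreover have "(2 :: int) ^ l q 0 mod 2 ^ Suc (l p 0) = 0"
      using that(3) by (simp add: le_imp_power_dvd mod_0_imp_dvd del: power_Suc)
    ultimately show False
      using residue2_U_set[OF that(1)] residue2_U_set[OF that(2)] by (simp del: power_Suc)
  qed
  then have "l m 0 = l n 0" using assms(4,5) by (meson linorder_neqE_nat)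
  then show ?thesis
    using assms(1-3) strict_mono_on_imp_inj_on[of "{1..}" "\<lambda>n. l n 0"]
    by (auto simp: admissible_levels_def inj_on_def)
qed

text \<open>
  The coding function is of interest only outside \<open>{t_n | n \<ge> 1} \<union> {0}\<close>; as a total
  function it also takes irrelevant values on that set, which consists of integers and is
  therefore disjoint from every orbit \<open>z + \<int>\<close> with \<open>z \<notin> \<int>\<close>.
\<close>

definition coding ::
  "(nat \<Rightarrow> nat \<Rightarrow> nat) \<Rightarrow> (nat \<Rightarrow> nat \<Rightarrow> letter) \<Rightarrow> padic2 \<Rightarrow> letter" where
  "coding l f z =
     (if \<exists>n\<ge>1. z \<in> U_set l n
      then let n = (THE n. 1 \<le> n \<and> z \<in> U_set l n) in f n (common_digits z (t_point l n))
      else Letter_a)"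

lemma coding_U_set:
  assumes "admissible_levels l" "1 \<le> n" "z \<in> U_set l n"
  shows "coding l f z = f n (common_digits z (t_point l n))"
proof -
  have "(THE n. 1 \<le> n \<and> z \<in> U_set l n) = n"
    using assms U_set_disjoint by blast
  then show ?thesis using assms(2,3) by (auto simp: coding_def)
qed

definition coding_shift ::
  "(nat \<Rightarrow> nat \<Rightarrow> nat) \<Rightarrow> (nat \<Rightarrow> nat \<Rightarrow> letter) \<Rightarrow> padic2 \<Rightarrow> (int \<Rightarrow> letter) set" where
  "coding_shift l f zhat = orbit_closure (\<lambda>n. coding l f (zhat + of_int n))"

end

theory Submission
  imports Defs
begin

text \<open>
  Over a point z the coordinate n is determined unless z + n is one of the exceptional points 0, t_1,
  t_2, ..., because the coding function is locally constant elsewhere. Let s be an independent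
  sequence of positions, thinned out so that it converges to \<open>\<sigma>\<close> in the 2-adic integers.
  A pattern that is not eventually constant can be realised only over the countably many z with
  \<open>z + \<sigma>\<close> exceptional, and a diagonal choice of the pattern rules these out one by one unless
  for some such z the point \<open>z + s n\<close> is exceptional for infinitely many n. Then z is an integer and
  infinitely many \<open>s n\<close> are positive, which excludes the backward case. In
  the fibre over 0 the letters at t_1, t_2, ... are limits of columns of f, so they form exactly the
  points of the shift of the language; this gives both directions of the forward case.
\<close>

section \<open>Orbit closures, compactness of the 2-adic integers, and the embedding of the
  integers\<close>

lemma letter_neq_exists: "\<exists>c :: letter. c \<noteq> d"
  by (metis letter.distinct(1))

lemma finite_letter: "finite (UNIV :: letter set)"
proof -
  have "(UNIV :: letter set) = {Letter_a, Letter_b}"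
    using letter.exhaust by auto
  then show ?thesis by (metis finite.emptyI finite.insertI)
qed

text \<open>Basic open sets of a product of discrete spaces restrict finitely many coordinates, and
  these fit into a window [-M, M].\<close>

lemma in_orbit_closure_iff:
  "x \<in> orbit_closure x0 \<longleftrightarrow> (\<forall>M. \<exists>k. \<forall>n. \<bar>n\<bar> \<le> int M \<longrightarrow> x n = x0 (n + k))"
proof
  assume x: "x \<in> orbit_closure x0"
  show "\<forall>M. \<exists>k. \<forall>n. \<bar>n\<bar> \<le> int M \<longrightarrow> x n = x0 (n + k)"
  proof
    fix M :: nat
    define T where "T = PiE UNIV (\<lambda>n. if \<bar>n\<bar> \<le> int M then {x n} else UNIV)"
    have "finite {n :: int. \<bar>n\<bar> \<le> int M}"
      by (rule finite_subset[of _ "{- int M..int M}"]) auto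
    then have "finite {n. (if \<bar>n\<bar> \<le> int M then {x n} else UNIV) \<noteq> UNIV}"
      by (rule finite_subset[rotated]) auto
    then have "openin (product_topology (\<lambda>_. discrete_topology UNIV) UNIV) T"
      unfolding T_def by (intro product_topology_basis) auto
    moreover have "x \<in> T"
      unfolding T_def by auto
    ultimately obtain y where "y \<in> T" "y \<in> range (\<lambda>k :: int. (\<lambda>n. x0 (n + k)))"
      using x unfolding orbit_closure_def in_closure_of by blast
    then obtain k where k: "(\<lambda>n. x0 (n + k)) \<in> T" by blast
    have "x n = x0 (n + k)" if "\<bar>n\<bar> \<le> int M" for n
      using PiE_mem[OF k[unfolded T_def], of n] that by simp
    then show "\<exists>k. \<forall>n. \<bar>n\<bar> \<le> int M \<longrightarrow> x n = x0 (n + k)" by blast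
  qed
next
  assume win: "\<forall>M. \<exists>k. \<forall>n. \<bar>n\<bar> \<le> int M \<longrightarrow> x n = x0 (n + k)"
  show "x \<in> orbit_closure x0"
    unfolding orbit_closure_def in_closure_of
  proof (intro conjI allI impI)
    show "x \<in> topspace (product_topology (\<lambda>_. discrete_topology UNIV) UNIV)" by simp
  next
    fix T :: "(int \<Rightarrow> letter) set"
    assume T: "x \<in> T \<and> openin (product_topology (\<lambda>_. discrete_topology UNIV) UNIV) T"
    obtain U where U: "finite {i. U i \<noteq> (UNIV :: letter set)}" "x \<in> PiE UNIV U" "PiE UNIV U \<subseteq> T"
      using T unfolding openin_product_topology_alt by force
    obtain M :: nat where M: "\<And>i. U i \<noteq> UNIV \<Longrightarrow> \<bar>i\<bar> \<le> int M"
    proof -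
      have "finite ((\<lambda>i. nat \<bar>i\<bar>) ` {i. U i \<noteq> UNIV})" using U(1) by simp
      then obtain M where "\<forall>m \<in> (\<lambda>i. nat \<bar>i\<bar>) ` {i. U i \<noteq> UNIV}. m \<le> M"
        using finite_nat_set_iff_bounded_le by blast
      then show thesis by (intro that[of M]) force
    qed
    obtain k where k: "\<And>n. \<bar>n\<bar> \<le> int M \<Longrightarrow> x n = x0 (n + k)" using win by blast
    have "x0 (n + k) \<in> U n" for n
    proof (cases "U n = UNIV")
      case False
      then show ?thesis using k[OF M[OF False]] PiE_mem[OF U(2), of n] by simp
    qed simp
    then have "(\<lambda>n. x0 (n + k)) \<in> T" using U(3) by (auto simp: PiE_iff)
    then show "\<exists>y. y \<in> range (\<lambda>k :: int. (\<lambda>n. x0 (n + k))) \<and> y \<in> T" by blast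
  qed
qed

text \<open>Koenig's argument: a residue modulo 2^m that occurs infinitely often has a lift modulo
  2^(m+1) that does too. Choosing such lifts coherently gives the limit, and each index is chosen so
  that the rate of convergence is explicit.\<close>

lemma padic2_subsequence:
  fixes u :: "nat \<Rightarrow> padic2"
  obtains z and r :: "nat \<Rightarrow> nat" where "strict_mono r" "\<And>m. 2 ^ m dvd u (r m) - z"
proof -
  define P where "P m c \<longleftrightarrow> infinite {n. residue2 (u n) m = c}" for m c
  have "\<exists>R. \<forall>m. P m (R m) \<and> R m = R (Suc m) mod 2 ^ m"
  proof (rule dependent_nat_choice)
    show "\<exists>c. P 0 c" by (auto simp: P_def)
  next
    fix c m assume "P m c"
    then have inf: "infinite {n. residue2 (u n) m = c}" by (simp add: P_def)
    have range: "residue2 w (Suc m) \<in> {0..<2 ^ Suc m}" for w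
      by (metis atLeastLessThan_iff pos_mod_bound pos_mod_sign residue2_mod_self
          zero_less_numeral zero_less_power)
    have "finite ((\<lambda>n. residue2 (u n) (Suc m)) ` {n. residue2 (u n) m = c})"
      by (rule finite_subset[of _ "{0..<2 ^ Suc m}"]) (use range in auto)
    from pigeonhole_infinite[OF inf this] obtain n0 where n0: "residue2 (u n0) m = c"
      and inf': "infinite {n \<in> {n. residue2 (u n) m = c}. residue2 (u n) (Suc m) = residue2 (u n0) (Suc m)}"
      by blast
    have "P (Suc m) (residue2 (u n0) (Suc m))"
      unfolding P_def by (rule infinite_super[OF _ inf']) auto
    moreover have "c = residue2 (u n0) (Suc m) mod 2 ^ m"
      using n0 by (simp only: residue2_Suc)
    ultimately show "\<exists>c'. P (Suc m) c' \<and> c = c' mod 2 ^ m" by blast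
  qed
  then obtain R where R: "\<And>m. P m (R m)" "\<And>m. R m = R (Suc m) mod 2 ^ m" by blast
  have z: "residue2 (Abs_padic2 R) = R"
    using R(2) by (intro Abs_padic2_inverse CollectI allI)
  have ex: "\<exists>n>N. residue2 (u n) m = R m" for m N
    using R(1)[of m] unfolding P_def infinite_nat_iff_unbounded by blast
  have "\<exists>r. \<forall>m. residue2 (u (r m)) m = R m \<and> r m < r (Suc m)"
    by (rule dependent_nat_choice) (use ex in blast)+
  then obtain r where r: "\<And>m. residue2 (u (r m)) m = R m" "\<And>m. r m < r (Suc m)" by blast
  show thesis
    by (rule that[of r "Abs_padic2 R"]) (auto simp: strict_mono_Suc_iff r two_power_dvd_diff_iff z)
qed

text \<open>A nonzero integer d is not divisible by 2^|d|, so comparing residues modulo this one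
  power suffices.\<close>

lemma of_int_padic2_eq_iff: "(of_int a :: padic2) = of_int b \<longleftrightarrow> a = b"
proof
  assume eq: "(of_int a :: padic2) = of_int b"
  define n where "n = nat \<bar>a - b\<bar>"
  have "2 ^ n dvd a - b"
    using arg_cong[OF eq, of "\<lambda>z. residue2 z n"] by (simp add: residue2_of_int mod_eq_dvd_iff)
  moreover have "\<bar>a - b\<bar> < 2 ^ n"
    unfolding n_def by (metis abs_ge_zero int_nat_eq of_nat_less_two_power)
  ultimately show "a = b"
    using zdvd_not_zless[of "\<bar>a - b\<bar>" "2 ^ n"] by force
qed simp

lemma dvd_diff_shift: "(d :: 'a :: comm_ring_1) dvd x - y \<Longrightarrow> d dvd x - z \<longleftrightarrow> d dvd y - z"
  using dvd_add_right_iff[of d "x - y" "y - z"] by simp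

lemma power2_dvd_mono: "m \<le> n \<Longrightarrow> (2 :: padic2) ^ n dvd z \<Longrightarrow> 2 ^ m dvd z"
  by (meson dvd_trans le_imp_power_dvd)

section \<open>The coding function away from and near its exceptional points\<close>

definition exceptional :: "(nat \<Rightarrow> nat \<Rightarrow> nat) \<Rightarrow> padic2 set" where
  "exceptional l = insert 0 (t_point l ` {1..})"

text \<open>If w lies in some \<open>U_set l n\<close>, that set is open and
  \<open>common_digits\<close> with t_n is locally constant away from t_n. Otherwise choose c with
  2^c not dividing w: each \<open>U_set l n\<close> with \<open>l n 0\<close> at least c consists of
  multiples of 2^c, and the others are unions of classes modulo 2^c, so the class of w meets none of
  them.\<close>

lemma coding_locally_constant:
  assumes "admissible_levels l" "w \<notin> exceptional l"
  obtains M where "\<And>w'. 2 ^ M dvd w' - w \<Longrightarrow> coding l f w' = coding l f w"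
proof (cases "\<exists>n\<ge>1. w \<in> U_set l n")
  case True
  then obtain n where n: "1 \<le> n" "w \<in> U_set l n" by blast
  have ne: "w \<noteq> t_point l n" using assms(2) n(1) by (auto simp: exceptional_def)
  define c where "c = common_digits w (t_point l n)"
  define M where "M = max (Suc c) (l n 0 + 1)"
  show thesis
  proof (rule that[of M])
    fix w' assume w': "2 ^ M dvd w' - w"
    have iff: "2 ^ i dvd w' - t_point l n \<longleftrightarrow> 2 ^ i dvd w - t_point l n" if "i \<le> M" for i
      using dvd_diff_shift power2_dvd_mono[OF that w'] by blast
    have "w' \<in> U_set l n" using n(2) iff[of "l n 0 + 1"] by (auto simp: U_set_def M_def)
    moreover have "\<not> 2 ^ Suc c dvd w' - t_point l n" "2 ^ c dvd w' - t_point l n"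
      using iff[of "Suc c"] iff[of c] common_digits_iff[OF ne, of c] common_digits_iff[OF ne, of "Suc c"]
      by (auto simp: M_def c_def simp del: power_Suc)
    moreover from this have "w' \<noteq> t_point l n" by auto
    ultimately have "common_digits w' (t_point l n) = c"
      using common_digits_iff by (metis le_antisym not_less_eq_eq)
    then show "coding l f w' = coding l f w"
      using coding_U_set[OF assms(1) n] coding_U_set[OF assms(1) n(1) \<open>w' \<in> U_set l n\<close>]
      by (simp add: c_def)
  qed
next
  case False
  have "w \<noteq> 0" using assms(2) by (auto simp: exceptional_def)
  then obtain c where c: "\<not> 2 ^ c dvd w"
    using common_digits_iff[of w 0] by (metis diff_zero not_less_eq_eq order_refl)
  show thesis
  proof (rule that[of c])
    fix w' assume w': "2 ^ c dvd w' - w"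
    have False if n: "1 \<le> n" "w' \<in> U_set l n" for n
    proof (cases "c \<le> l n 0")
      case True
      have "2 ^ c dvd w' - t_point l n"
        by (rule power2_dvd_mono[of c "l n 0 + 1"]) (use n(2) True in \<open>simp_all add: U_set_def\<close>)
      moreover have "2 ^ c dvd t_point l n" using True by (simp add: t_point_def le_imp_power_dvd)
      ultimately have "2 ^ c dvd w'" by (metis diff_add_cancel dvd_add)
      then show False using c w' dvd_diff_shift[of "2 ^ c" w' w 0] by simp
    next
      case False
      then have "2 ^ (l n 0 + 1) dvd w' - w" by (intro power2_dvd_mono[OF _ w']) simp
      then have "w \<in> U_set l n" using n(2) dvd_diff_shift by (auto simp: U_set_def)
      then show False using \<open>\<not> (\<exists>n\<ge>1. w \<in> U_set l n)\<close> n(1) by blast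
    qed
    then have "\<not> (\<exists>n\<ge>1. w' \<in> U_set l n)" by blast
    then show "coding l f w' = coding l f w" using False by (simp only: coding_def if_False)
  qed
qed

text \<open>The argument of \<open>f m\<close> does not depend on m: for nonzero u divisible by a
  high power of 2, the letters at u + t_1, ..., u + t_N form one column of f, taken at the 2-adic
  valuation of u.\<close>

lemma coding_near_t_point:
  assumes "admissible_levels l" "1 \<le> m" "2 ^ (l m 0 + 1) dvd u"
  shows "coding l f (u + t_point l m) = f m (common_digits u 0)"
proof -
  have "u + t_point l m \<in> U_set l m" using assms(3) by (simp add: U_set_def)
  from coding_U_set[OF assms(1,2) this] show ?thesis by (simp add: common_digits_def)
qed

section \<open>Points of the shift in the fibre over a 2-adic integer\<close>

text \<open>This is the fibre relation of the odometer factor, phrased by approximation so that no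
  factor map has to be constructed: translates of \<open>zhat\<close> converge to z while their
  codings converge to x.\<close>

definition lies_over ::
  "(nat \<Rightarrow> nat \<Rightarrow> nat) \<Rightarrow> (nat \<Rightarrow> nat \<Rightarrow> letter) \<Rightarrow> padic2 \<Rightarrow> (int \<Rightarrow> letter) \<Rightarrow> padic2 \<Rightarrow> bool" where
  "lies_over l f zhat x z \<longleftrightarrow>
     (\<forall>M. \<exists>k. 2 ^ M dvd zhat + of_int k - z \<and>
        (\<forall>n. \<bar>n\<bar> \<le> int M \<longrightarrow> x n = coding l f (zhat + of_int k + of_int n)))"

lemma coding_shift_lies_over:
  assumes "x \<in> coding_shift l f zhat"
  obtains z where "lies_over l f zhat x z"
proof -
  have "\<forall>M. \<exists>k. \<forall>n. \<bar>n\<bar> \<le> int M \<longrightarrow> x n = coding l f (zhat + of_int (n + k))"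
    using assms by (simp add: coding_shift_def in_orbit_closure_iff)
  then obtain k where k: "\<And>M n. \<bar>n\<bar> \<le> int M \<Longrightarrow> x n = coding l f (zhat + of_int (n + k M))"
    by metis
  obtain z r where r: "strict_mono r" "\<And>m. 2 ^ m dvd (zhat + of_int (k (r m))) - z"
    using padic2_subsequence[of "\<lambda>M. zhat + of_int (k M)"] by blast
  \<comment> \<open>The window of size \<open>r M\<close> contains the window of size M because
    \<open>r M\<close> is at least M.\<close>
  have "x n = coding l f (zhat + of_int (k (r M)) + of_int n)" if "\<bar>n\<bar> \<le> int M" for n M
    using k[of n "r M"] that strict_mono_imp_increasing[OF r(1), of M] by (simp add: ac_simps)
  then have "lies_over l f zhat x z" using r(2) unfolding lies_over_def by blast
  then show thesis by (rule that)
qed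

lemma lies_over_eq_coding:
  assumes "admissible_levels l" "lies_over l f zhat x z" "z + of_int n \<notin> exceptional l"
  shows "x n = coding l f (z + of_int n)"
proof -
  obtain M where M: "\<And>w'. 2 ^ M dvd w' - (z + of_int n) \<Longrightarrow> coding l f w' = coding l f (z + of_int n)"
    using coding_locally_constant[OF assms(1,3)] by blast
  obtain k where k: "2 ^ max M (nat \<bar>n\<bar>) dvd zhat + of_int k - z"
    "x n = coding l f (zhat + of_int k + of_int n)"
    using assms(2) unfolding lies_over_def by (metis int_nat_eq abs_ge_zero max.cobounded2 of_nat_mono)
  have "2 ^ M dvd zhat + of_int k - z" using k(1) by (rule power2_dvd_mono[rotated]) simp
  then show ?thesis using M[of "zhat + of_int k + of_int n"] k(2) by (simp add: algebra_simps)
qed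

text \<open>A translate approximating z well enough to see coordinate \<open>s n\<close> is moved by
  \<open>s n\<close> close to \<open>z + \<sigma>\<close>, where the coding is locally constant. So
  a pattern along s that is not eventually constant forces \<open>z + \<sigma>\<close> to be
  exceptional.\<close>

lemma lies_over_eventually_constant:
  fixes s :: "nat \<Rightarrow> int"
  assumes "admissible_levels l" "lies_over l f zhat x z"
    and s: "\<And>n. 2 ^ n dvd of_int (s n) - \<sigma>"
    and "z + \<sigma> \<notin> exceptional l"
  obtains M where "\<And>n. M \<le> n \<Longrightarrow> x (s n) = coding l f (z + \<sigma>)"
proof -
  obtain M where M: "\<And>w'. 2 ^ M dvd w' - (z + \<sigma>) \<Longrightarrow> coding l f w' = coding l f (z + \<sigma>)"
    using coding_locally_constant[OF assms(1,4)] by blast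
  have "x (s n) = coding l f (z + \<sigma>)" if "M \<le> n" for n
  proof -
    obtain k where k: "2 ^ max M (nat \<bar>s n\<bar>) dvd zhat + of_int k - z"
      "x (s n) = coding l f (zhat + of_int k + of_int (s n))"
      using assms(2) unfolding lies_over_def by (metis int_nat_eq abs_ge_zero max.cobounded2 of_nat_mono)
    have "2 ^ M dvd zhat + of_int k - z" using k(1) by (rule power2_dvd_mono[rotated]) simp
    moreover have "2 ^ M dvd of_int (s n) - \<sigma>" using s that by (rule power2_dvd_mono[rotated])
    ultimately have "2 ^ M dvd (zhat + of_int k - z) + (of_int (s n) - \<sigma>)" by (rule dvd_add)
    then show ?thesis using M[of "zhat + of_int k + of_int (s n)"] k(2) by (simp add: algebra_simps)
  qed
  then show thesis by (rule that)
qed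

lemma level_mono:
  assumes "admissible_levels l" "1 \<le> m" "m \<le> n"
  shows "l m 0 \<le> l n 0"
  using assms strict_mono_on_leD[of "{1..}" "\<lambda>n. l n 0" m n] by (auto simp: admissible_levels_def)

text \<open>The blocks of level N cover all arguments from \<open>l N 0\<close> on, so v lies in one
  of them.\<close>

lemma column_word_in_language:
  assumes "admissible_levels l" "adapted_family l \<L> f" "1 \<le> N" "l N 0 \<le> v"
  shows "column_word f N v \<in> \<L>"
proof -
  have mono: "strict_mono (l N)" using assms(1,3) by (auto simp: admissible_levels_def)
  define i where "i = (GREATEST i. l N i \<le> v)"
  have bound: "j \<le> v" if "l N j \<le> v" for j
    using strict_mono_imp_increasing[OF mono, of j] that by simp
  have "l N i \<le> v"
    unfolding i_def by (rule GreatestI_nat[where k = 0 and b = v]) (use assms(4) bound in auto)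
  moreover have "\<not> l N (Suc i) \<le> v"
  proof
    assume "l N (Suc i) \<le> v"
    then have "Suc i \<le> (GREATEST i. l N i \<le> v)" using bound by (rule Greatest_le_nat)
    then show False by (simp flip: i_def)
  qed
  ultimately have "v \<in> {l N i..<l N (Suc i)}" by simp
  then have "column_word f N v = column_word f N (l N i)" "column_word f N (l N i) \<in> \<L>"
    using assms(2,3) by (auto simp: adapted_family_def)
  then show ?thesis by simp
qed

lemma column_word_eq_map: "column_word f N v = map (\<lambda>m. f (Suc m) v) [0..<N]"
  unfolding column_word_def by (rule nth_equalityI) (simp_all del: upt_Suc)

text \<open>Over k the listed coordinates sit at t_1, t_2, .... The approximating points u tend to 0
  but are nonzero, since \<open>zhat\<close> is not an integer; so an initial segment of letters is
  a column at the valuation of u, hence a word of the language. Other subwords follow by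
  closure.\<close>

lemma lies_over_integer_language:
  assumes "admissible_levels l" "right_extendable_language \<L>" "adapted_family l \<L> f" "zhat \<notin> \<int>"
    and over: "lies_over l f zhat x (of_int k)"
  shows "(\<lambda>m. x (2 ^ l (Suc m) 0 - k)) \<in> language_shift \<L>"
  unfolding language_shift_def
proof (intro CollectI allI impI)
  fix i j :: nat assume ij: "i < j"
  define y where "y m = x (2 ^ l (Suc m) 0 - k)" for m
  \<comment> \<open>The first two summands put 2^(l n 0) - k into the window for n = 1, ..., j; the
    last two make u divisible by 2^(l j 0 + 1), which brings u + t_n into \<open>U_set l n\<close>
    and the valuation of u into a block of level j.\<close>
  define M where "M = nat \<bar>k\<bar> + 2 ^ l j 0 + l j 0 + 1"
  obtain k' where k': "2 ^ M dvd zhat + of_int k' - of_int k"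
    "\<And>n. \<bar>n\<bar> \<le> int M \<Longrightarrow> x n = coding l f (zhat + of_int k' + of_int n)"
    using over unfolding lies_over_def by blast
  define u where "u = zhat + of_int k' - of_int k"
  define v where "v = common_digits u 0"
  have "u \<noteq> 0"
  proof
    assume "u = 0"
    then have "zhat = of_int (k - k')" by (simp add: u_def algebra_simps)
    then show False using assms(4) by (metis Ints_of_int)
  qed
  then have "M \<le> v" using k'(1) by (simp add: v_def common_digits_iff u_def)
  have y: "y m = f (Suc m) v" if "m < j" for m
  proof -
    have le: "l (Suc m) 0 \<le> l j 0" using that by (intro level_mono[OF assms(1)]) auto
    have "\<bar>2 ^ l (Suc m) 0 - k\<bar> \<le> \<bar>k\<bar> + 2 ^ l (Suc m) 0"
      using abs_triangle_ineq4[of "2 ^ l (Suc m) 0" k] by simp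
    moreover have "(2 :: int) ^ l (Suc m) 0 \<le> 2 ^ l j 0" using le by (intro power_increasing) auto
    moreover have "int M = \<bar>k\<bar> + 2 ^ l j 0 + int (l j 0) + 1" by (simp add: M_def)
    ultimately have "\<bar>2 ^ l (Suc m) 0 - k\<bar> \<le> int M" by linarith
    then have "y m = coding l f (u + t_point l (Suc m))"
      using k'(2)[of "2 ^ l (Suc m) 0 - k"] by (simp add: y_def u_def t_point_def algebra_simps)
    also have "2 ^ (l (Suc m) 0 + 1) dvd u"
      unfolding u_def by (rule power2_dvd_mono[OF _ k'(1)]) (use le in \<open>simp add: M_def\<close>)
    then have "coding l f (u + t_point l (Suc m)) = f (Suc m) v"
      unfolding v_def by (intro coding_near_t_point[OF assms(1)]) auto
    finally show ?thesis .
  qed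
  have "column_word f j v \<in> \<L>"
    using \<open>M \<le> v\<close> ij by (intro column_word_in_language[OF assms(1,3)]) (auto simp: M_def)
  moreover have "column_word f j v = map y [0..<j]"
    using y by (simp add: column_word_eq_map)
  moreover have "sublist (map y [i..<j]) (map y [0..<j])"
    using upt_add_eq_append[of 0 i "j - i"] ij by (simp add: sublist_append_rightI)
  moreover have "map y [i..<j] \<noteq> []" using ij by simp
  ultimately have "map y [i..<j] \<in> \<L>"
    using assms(2) unfolding right_extendable_language_def by metis
  then show "map (\<lambda>m. x (2 ^ l (Suc m) 0 - k)) [i..<j] \<in> \<L>" by (simp add: y_def [abs_def])
qed

section \<open>The diagonal argument against countably many fibres\<close>

text \<open>
  Disjoint infinite blocks of coordinates let one pattern defeat countably many fibres at once:
  the block with index \<open>Suc j\<close> avoids the fibre over \<open>d j - \<sigma>\<close>, and the block with index 0 is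
  used to keep the pattern from being eventually constant.
\<close>

lemma unrealised_pattern:
  fixes s :: "nat \<Rightarrow> int"
  assumes adm: "admissible_levels l"
    and indep: "\<And>\<phi> :: nat \<Rightarrow> letter. \<exists>x\<in>coding_shift l f zhat. \<forall>n. x (s n) = \<phi> n"
    and fibre: "\<And>z (e :: nat \<Rightarrow> nat). inj e \<Longrightarrow> \<exists>\<psi>. \<forall>x. lies_over l f zhat x z \<longrightarrow> (\<exists>i. x (s (e i)) \<noteq> \<psi> i)"
  shows False
proof -
  obtain \<sigma> :: padic2 and r where r: "strict_mono r" "\<And>m. 2 ^ m dvd of_int (s (r m)) - \<sigma>"
    using padic2_subsequence[of "\<lambda>n. of_int (s n)"] by blast
  \<comment> \<open>An enumeration of the exceptional points; index 0 is free for the point 0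
    because t_n starts at n = 1.\<close>
  define d where "d j = (if j = 0 then 0 else t_point l j)" for j
  define e where "e j i = r (prod_encode (Suc j, i))" for j i
  have inj_r: "inj r" using r(1) by (rule strict_mono_imp_inj_on)
  have "inj (e j)" for j
    unfolding inj_def e_def using inj_r by (metis injD prod.inject prod_encode_eq)
  then have "\<forall>j. \<exists>\<psi>. \<forall>x. lies_over l f zhat x (d j - \<sigma>) \<longrightarrow> (\<exists>i. x (s (e j i)) \<noteq> \<psi> i)"
    by (intro allI fibre)
  then obtain \<psi> where \<psi>: "\<And>j x. lies_over l f zhat x (d j - \<sigma>) \<Longrightarrow> \<exists>i. x (s (e j i)) \<noteq> \<psi> j i"
    by metis
  define \<chi> where "\<chi> n = (case prod_decode n of
      (0, i) \<Rightarrow> if even i then Letter_a else Letter_b | (Suc j, i) \<Rightarrow> \<psi> j i)" for n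
  obtain x where x: "x \<in> coding_shift l f zhat" "\<And>n. x (s n) = \<chi> (inv r n)"
    using indep[of "\<lambda>n. \<chi> (inv r n)"] by blast
  have \<chi>: "x (s (r n)) = \<chi> n" for n using x(2) inj_r by simp
  obtain z where z: "lies_over l f zhat x z" using x(1) by (rule coding_shift_lies_over)
  have "z + \<sigma> \<in> exceptional l"
  proof (rule ccontr)
    assume "z + \<sigma> \<notin> exceptional l"
    then obtain M where M: "\<And>n. M \<le> n \<Longrightarrow> x (s (r n)) = coding l f (z + \<sigma>)"
      using lies_over_eventually_constant[OF adm z, of "\<lambda>n. s (r n)" \<sigma>] r(2) by blast
    \<comment> \<open>Both codes are at least M, since \<open>prod_encode (0, i)\<close> is at least
      i, yet block 0 alternates between the two letters.\<close>
    have "\<chi> (prod_encode (0, 2 * M)) = \<chi> (prod_encode (0, Suc (2 * M)))"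
      using M[of "prod_encode (0, 2 * M)"] M[of "prod_encode (0, Suc (2 * M))"]
        le_prod_encode_2[of "2 * M" 0] le_prod_encode_2[of "Suc (2 * M)" 0] \<chi> by simp
    then show False by (simp add: \<chi>_def)
  qed
  moreover have "d ` UNIV = exceptional l"
    unfolding exceptional_def d_def by (auto simp: image_iff)
  ultimately obtain j where "z + \<sigma> = d j" by (metis imageE)
  then have "z = d j - \<sigma>" by (simp add: algebra_simps)
  then obtain i where "x (s (e j i)) \<noteq> \<psi> j i" using \<psi> z by blast
  moreover have "x (s (e j i)) = \<psi> j i" using \<chi> by (simp add: e_def \<chi>_def)
  ultimately show False by simp
qed

text \<open>One coordinate that is constant on the fibre suffices: prescribe the other letter
  there.\<close>

lemma fibre_determined_coordinate:
  assumes "admissible_levels l" "z + of_int (s (e i)) \<notin> exceptional l"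
  shows "\<exists>\<psi>. \<forall>x. lies_over l f zhat x z \<longrightarrow> (\<exists>i. x (s (e i)) \<noteq> \<psi> i)"
proof -
  obtain c where "c \<noteq> coding l f (z + of_int (s (e i)))" using letter_neq_exists by blast
  then show ?thesis using lies_over_eq_coding[OF assms(1) _ assms(2)] by (intro exI[of _ "\<lambda>_. c"]) metis
qed

lemma exceptional_cases:
  assumes "w \<in> exceptional l"
  obtains (zero) "w = of_int 0" | (power) m where "w = of_int (2 ^ l (Suc m) 0)"
proof -
  consider "w = 0" | n where "1 \<le> n" "w = t_point l n"
    using assms by (auto simp: exceptional_def)
  then show thesis
  proof cases
    case (2 n)
    then show thesis by (intro power[of "n - 1"]) (simp add: t_point_def)
  qed (use zero in simp)
qed

lemma independent_inj:
  fixes s :: "nat \<Rightarrow> int"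
  assumes "\<And>\<phi> :: nat \<Rightarrow> letter. \<exists>x\<in>X. \<forall>n. x (s n) = \<phi> n"
  shows "inj s"
proof (rule injI, rule ccontr)
  fix m n assume "s m = s n" "m \<noteq> n"
  then show False using assms[of "\<lambda>i. if i = m then Letter_a else Letter_b"]
    by (metis letter.distinct(1))
qed

section \<open>Backward tameness\<close>

lemma coding_shift_backward_tame:
  assumes adm: "admissible_levels l"
  shows "backward_tame (coding_shift l f zhat)"
proof
  assume "backward_nontame (coding_shift l f zhat)"
  then obtain s :: "nat \<Rightarrow> int" where s: "\<And>n. s n < 0"
    "\<And>\<phi> :: nat \<Rightarrow> letter. \<exists>x\<in>coding_shift l f zhat. \<forall>n. x (s n) = \<phi> n"
    unfolding backward_nontame_def by blast
  show False
  proof (rule unrealised_pattern[OF adm s(2)])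
    fix z and e :: "nat \<Rightarrow> nat" assume e: "inj e"
    \<comment> \<open>Otherwise every z + s (e i) is a nonnegative integer. Then z is an integer and
      s (e i) is at least -z; being negative, it takes finitely many values, against
      injectivity.\<close>
    have "\<exists>i. z + of_int (s (e i)) \<notin> exceptional l"
    proof (rule ccontr)
      assume "\<not> ?thesis"
      then have "\<exists>p\<ge>0. z + of_int (s (e i)) = of_int p" for i
        by (metis exceptional_cases order_refl zero_le_numeral zero_le_power)
      then obtain p where p: "\<And>i. 0 \<le> p i" "\<And>i. z + of_int (s (e i)) = of_int (p i)" by metis
      have "of_int (p i - s (e i)) = (of_int (p 0 - s (e 0)) :: padic2)" for i
        using p(2)[of i] p(2)[of 0] by (metis add_diff_cancel_right' of_int_diff)
      then have "p i - s (e i) = p 0 - s (e 0)" for i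
        by (simp only: of_int_padic2_eq_iff)
      then have "- (p 0 - s (e 0)) \<le> s (e i)" for i using p(1)[of i] by (smt (verit))
      then have "range (\<lambda>i. s (e i)) \<subseteq> {- (p 0 - s (e 0))..0}" using less_imp_le[OF s(1)] by auto
      then have "finite (range (\<lambda>i. s (e i)))" by (rule finite_subset) simp
      moreover have "inj (\<lambda>i. s (e i))"
        using e independent_inj[OF s(2)] by (simp add: inj_def)
      ultimately show False using finite_imageD by blast
    qed
    then show "\<exists>\<psi>. \<forall>x. lies_over l f zhat x z \<longrightarrow> (\<exists>i. x (s (e i)) \<noteq> \<psi> i)"
      by (elim exE) (rule fibre_determined_coordinate[OF adm])
  qed
qed

section \<open>Forward tameness and the language shift\<close>

text \<open>The only fibres without a determined coordinate among the given positions lie over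
  integers k with all k + s (e i) exceptional. There the letters at the t_m form a point of the
  language shift, whose tameness supplies a missing pattern.\<close>

lemma forward_nontame_imp_language_nontame:
  assumes adm: "admissible_levels l" and lang: "right_extendable_language \<L>"
    and fam: "adapted_family l \<L> f" and zhat: "zhat \<notin> \<int>"
    and "forward_nontame (coding_shift l f zhat)"
  shows "one_sided_nontame (language_shift \<L>)"
proof (rule ccontr)
  assume tame: "one_sided_tame (language_shift \<L>)"
  obtain s :: "nat \<Rightarrow> int" where
    s: "\<And>\<phi> :: nat \<Rightarrow> letter. \<exists>x\<in>coding_shift l f zhat. \<forall>n. x (s n) = \<phi> n"
    using assms(5) unfolding forward_nontame_def by blast
  have inj_s: "inj s" using s by (rule independent_inj)
  show False
  proof (rule unrealised_pattern[OF adm s])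
    fix z and e :: "nat \<Rightarrow> nat" assume e: "inj e"
    show "\<exists>\<psi>. \<forall>x. lies_over l f zhat x z \<longrightarrow> (\<exists>i. x (s (e i)) \<noteq> \<psi> i)"
    proof (cases "\<forall>i. z + of_int (s (e i)) \<in> exceptional l")
      case False
      then obtain i where "z + of_int (s (e i)) \<notin> exceptional l" by blast
      then show ?thesis by (rule fibre_determined_coordinate[OF adm])
    next
      case True
      then obtain p where "z + of_int (s (e 0)) = of_int p"
        by (meson exceptional_cases)
      then have "z = of_int (p - s (e 0))" by (simp add: algebra_simps)
      then obtain k where z: "z = of_int k" by blast
      \<comment> \<open>By injectivity at most one position hits the exceptional point 0, about
        which the language says nothing; the pattern is used only after it.\<close>
      obtain i0 where i0: "\<And>i. k + s (e (i0 + i)) \<noteq> 0"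
      proof (cases "\<exists>j. k + s (e j) = 0")
        case True
        then obtain j where j: "k + s (e j) = 0" by blast
        have "k + s (e (Suc j + i)) \<noteq> 0" for i
        proof
          assume "k + s (e (Suc j + i)) = 0"
          then have "s (e (Suc j + i)) = s (e j)" using j by simp
          then have "Suc j + i = j" using inj_s e by (auto dest!: injD)
          then show False by simp
        qed
        then show thesis by (rule that)
      next
        case False
        then show thesis by (intro that[of 0]) auto
      qed
      have "\<exists>m. k + s (e (i0 + i)) = 2 ^ l (Suc m) 0" for i
      proof -
        have "of_int (k + s (e (i0 + i))) \<in> exceptional l" using True z by simp
        then show ?thesis
          by (cases rule: exceptional_cases) (use i0 in \<open>auto simp only: of_int_padic2_eq_iff\<close>)
      qed
      then obtain m where m: "\<And>i. k + s (e (i0 + i)) = 2 ^ l (Suc (m i)) 0" by metis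
      obtain \<psi> where \<psi>: "\<And>y. y \<in> language_shift \<L> \<Longrightarrow> \<exists>i. y (m i) \<noteq> \<psi> i"
        using tame unfolding one_sided_nontame_def by metis
      \<comment> \<open>Values of the pattern before \<open>i0\<close> are immaterial: the mismatch
        is found from \<open>i0\<close> on.\<close>
      have "\<exists>i. x (s (e i)) \<noteq> \<psi> (i - i0)" if x: "lies_over l f zhat x z" for x
      proof -
        obtain i where "x (2 ^ l (Suc (m i)) 0 - k) \<noteq> \<psi> i"
          using \<psi>[OF lies_over_integer_language[OF adm lang fam zhat x[unfolded z]]] by blast
        then have "x (s (e (i0 + i))) \<noteq> \<psi> (i0 + i - i0)" by (simp flip: m)
        then show ?thesis by blast
      qed
      then show ?thesis by (intro exI[of _ "\<lambda>i. \<psi> (i - i0)"]) blast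
    qed
  qed
qed

text \<open>An integer translation moves z into the class of 2^v modulo 2^(v+1), where the valuation
  is exactly v.\<close>

lemma exists_translate_of_valuation:
  fixes z :: padic2
  obtains k where "2 ^ v dvd z + of_int k" "\<not> 2 ^ Suc v dvd z + of_int k"
proof -
  define k where "k = 2 ^ v - residue2 z (Suc v)"
  have dvd_iff: "2 ^ i dvd z + of_int k \<longleftrightarrow> residue2 z i = (- k) mod 2 ^ i" for i
    using two_power_dvd_diff_iff[of i z "of_int (- k)"] residue2_of_int[of "- k" i] by simp
  have "residue2 z v = (- k) mod 2 ^ v"
    using residue2_Suc[of z v] by (simp add: k_def mod_simps)
  moreover have "residue2 z (Suc v) \<noteq> (- k) mod 2 ^ Suc v"
  proof
    assume "residue2 z (Suc v) = (- k) mod 2 ^ Suc v"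
    then have "residue2 z (Suc v) mod 2 ^ Suc v = (- k) mod 2 ^ Suc v" by (simp del: power_Suc)
    then have "(2 :: int) ^ Suc v dvd residue2 z (Suc v) - - k" by (simp only: mod_eq_dvd_iff)
    then have "(2 :: int) ^ Suc v dvd 2 ^ v" by (simp add: k_def del: power_Suc)
    then have "(2 :: int) ^ Suc v \<le> 2 ^ v" by (rule zdvd_imp_le) simp
    then show False by simp
  qed
  ultimately show thesis using that[of k] dvd_iff by blast
qed

text \<open>Every word of the language recurs as a column at arbitrarily late block end points.
  Translating \<open>zhat\<close> to have such an end point as valuation makes the letters at t_1,
  ..., t_N spell the first N letters of y; x is a limit of these translates in the fibre over
  0.\<close>

lemma language_point_realised:
  assumes adm: "admissible_levels l" and fam: "adapted_family l \<L> f"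
    and y: "y \<in> language_shift \<L>"
  shows "\<exists>x\<in>coding_shift l f zhat. \<forall>m. x (2 ^ l (Suc m) 0) = y m"
proof -
  have "\<exists>k v. N < v \<and> l N 0 < v \<and> 2 ^ v dvd zhat + of_int k \<and> \<not> 2 ^ Suc v dvd zhat + of_int k \<and>
      (\<forall>m<N. f (Suc m) v = y m)" for N
  \<comment> \<open>Level 0 of l and f carries no information, but then no letter is prescribed
    either.\<close>
  proof (cases "N = 0")
    case True
    obtain k where "2 ^ Suc (l N 0) dvd zhat + of_int k" "\<not> 2 ^ Suc (Suc (l N 0)) dvd zhat + of_int k"
      by (rule exists_translate_of_valuation)
    then show ?thesis using True by (intro exI[of _ k] exI[of _ "Suc (l N 0)"]) simp
  next
    case False
    then have "map y [0..<N] \<in> \<L>" using y by (simp add: language_shift_def)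
    then obtain i where i: "i \<ge> Suc N" "map y [0..<N] = column_word f N (l N i)"
      using fam False unfolding adapted_family_def
      by (metis One_nat_def Suc_leI diff_zero length_map length_upt neq0_conv)
    have mono: "strict_mono (l N)" using adm False by (simp add: admissible_levels_def)
    have "N < l N i" using strict_mono_imp_increasing[OF mono, of i] i(1) by simp
    moreover have "l N 0 < l N i" using mono i(1) by (simp add: strict_mono_less)
    moreover have "f (Suc m) (l N i) = y m" if "m < N" for m
      using arg_cong[OF i(2), of "\<lambda>w. w ! m"] that by (simp add: column_word_eq_map)
    moreover obtain k where "2 ^ l N i dvd zhat + of_int k" "\<not> 2 ^ Suc (l N i) dvd zhat + of_int k"
      by (rule exists_translate_of_valuation)
    ultimately show ?thesis by blast
  qed
  then obtain k v where kv: "\<And>N. N < v N" "\<And>N. l N 0 < v N"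
    "\<And>N. 2 ^ v N dvd zhat + of_int (k N)" "\<And>N. \<not> 2 ^ Suc (v N) dvd zhat + of_int (k N)"
    "\<And>N m. m < N \<Longrightarrow> f (Suc m) (v N) = y m" by metis
  define u where "u N = zhat + of_int (k N)" for N
  have u0: "u N \<noteq> 0" for N using kv(4)[of N] by (auto simp: u_def)
  have val: "common_digits (u N) 0 = v N" for N
    using common_digits_iff[OF u0[of N]] kv(3,4)[of N] unfolding u_def
    by (metis diff_zero le_antisym not_less_eq_eq)
  \<comment> \<open>The letter at \<open>u N\<close> itself, which becomes coordinate 0 of x, is not
    controlled; it is made constant by keeping infinitely many N.\<close>
  obtain c where c: "infinite {N. coding l f (u N) = c}"
    using pigeonhole_infinite[of "UNIV :: nat set" "\<lambda>N. coding l f (u N)"]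
      finite_subset[OF subset_UNIV finite_letter] by auto
  \<comment> \<open>The choice by \<open>SOME\<close> is unambiguous because the exponents are
    distinct. All remaining coordinates are determined over 0.\<close>
  define x where "x n = (if n = 0 then c
      else if \<exists>m. n = 2 ^ l (Suc m) 0 then y (SOME m. n = 2 ^ l (Suc m) 0)
      else coding l f (of_int n))" for n :: int
  have inj_l: "m = m'" if "l (Suc m) 0 = l (Suc m') 0" for m m'
    using adm that strict_mono_on_imp_inj_on[of "{1..}" "\<lambda>n. l n 0"]
    by (auto simp: admissible_levels_def inj_on_def)
  have x_pow: "x (2 ^ l (Suc m) 0) = y m" for m
  proof -
    have "(SOME m'. (2 :: int) ^ l (Suc m) 0 = 2 ^ l (Suc m') 0) = m"
      by (rule some_equality) (use inj_l in auto)
    then show ?thesis by (auto simp: x_def)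
  qed
  \<comment> \<open>Each coordinate stabilises along the kept N: at 0 by the choice of c, at t_(m+1)
    from N = m+1 on by the columns, elsewhere by local constancy.\<close>
  have "\<exists>R. \<forall>N\<ge>R. coding l f (u N) = c \<longrightarrow> x n = coding l f (u N + of_int n)" for n
  proof -
    consider "n = 0" | m where "n = 2 ^ l (Suc m) 0" | "n \<noteq> 0" "\<nexists>m. n = 2 ^ l (Suc m) 0" by blast
    then show ?thesis
    proof cases
      case 1
      then show ?thesis by (simp add: x_def)
    next
      case (2 m)
      have "x n = coding l f (u N + of_int n)" if "Suc m \<le> N" for N
      proof -
        have "2 ^ (l (Suc m) 0 + 1) dvd u N"
          using level_mono[OF adm _ that] kv(2)[of N] unfolding u_def
          by (intro power2_dvd_mono[OF _ kv(3)]) simp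
        then have "coding l f (u N + t_point l (Suc m)) = f (Suc m) (v N)"
          using coding_near_t_point[OF adm, of "Suc m" "u N" f] val by simp
        then show ?thesis using x_pow[of m] kv(5)[of m N] that 2 by (simp add: t_point_def)
      qed
      then show ?thesis by blast
    next
      case 3
      have "of_int n \<notin> exceptional l"
      proof
        assume "of_int n \<in> exceptional l"
        then show False
          by (cases rule: exceptional_cases) (use 3 in \<open>auto simp only: of_int_padic2_eq_iff\<close>)
      qed
      then obtain M where M: "\<And>w'. 2 ^ M dvd w' - of_int n \<Longrightarrow> coding l f w' = coding l f (of_int n)"
        using coding_locally_constant[OF adm] by blast
      have "x n = coding l f (u N + of_int n)" if "M \<le> N" for N
      proof -
        have "2 ^ M dvd u N"
          using that kv(1)[of N] unfolding u_def by (intro power2_dvd_mono[OF _ kv(3)]) simp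
        then show ?thesis using M[of "u N + of_int n"] 3 by (simp add: x_def)
      qed
      then show ?thesis by blast
    qed
  qed
  then obtain R where R: "\<And>n N. R n \<le> N \<Longrightarrow> coding l f (u N) = c \<Longrightarrow> x n = coding l f (u N + of_int n)"
    by metis
  have "x \<in> coding_shift l f zhat"
    unfolding coding_shift_def in_orbit_closure_iff
  proof
    fix M :: nat
    \<comment> \<open>A common threshold for the finite window; infinitely many N are kept, so one
      of them exceeds it.\<close>
    define B where "B = Max (R ` {- int M..int M})"
    obtain N where N: "B < N" "coding l f (u N) = c"
      using c unfolding infinite_nat_iff_unbounded by blast
    have "x n = coding l f (zhat + of_int (n + k N))" if "\<bar>n\<bar> \<le> int M" for n
    proof -
      have "R n \<le> B" unfolding B_def by (intro Max_ge imageI) (use that in auto)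
      then show ?thesis using R[of n N] N by (simp add: u_def ac_simps)
    qed
    then show "\<exists>k. \<forall>n. \<bar>n\<bar> \<le> int M \<longrightarrow> x n = coding l f (zhat + of_int (n + k))" by blast
  qed
  then show ?thesis using x_pow by blast
qed

lemma language_nontame_imp_forward_nontame:
  assumes "admissible_levels l" "adapted_family l \<L> f" "one_sided_nontame (language_shift \<L>)"
  shows "forward_nontame (coding_shift l f zhat)"
proof -
  obtain \<nu> :: "nat \<Rightarrow> nat" where \<nu>: "\<And>\<phi>. \<exists>y\<in>language_shift \<L>. \<forall>n. y (\<nu> n) = \<phi> n"
    using assms(3) unfolding one_sided_nontame_def by blast
  have "\<exists>x\<in>coding_shift l f zhat. \<forall>n. x (2 ^ l (Suc (\<nu> n)) 0) = \<phi> n" for \<phi>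
    using \<nu>[of \<phi>] language_point_realised[OF assms(1,2)] by metis
  then show ?thesis
    unfolding forward_nontame_def by (intro exI[of _ "\<lambda>n. 2 ^ l (Suc (\<nu> n)) 0"]) simp
qed

theorem theorem6p4:
  fixes l :: "nat \<Rightarrow> nat \<Rightarrow> nat"
    and \<L> :: "letter list set"
    and f :: "nat \<Rightarrow> nat \<Rightarrow> letter"
    and zhat :: padic2
  assumes "admissible_levels l"
    and "right_extendable_language \<L>"
    and "adapted_family l \<L> f"
    and "zhat \<notin> \<int>"
  shows "backward_tame (coding_shift l f zhat) \<and>
    (forward_tame (coding_shift l f zhat) \<longleftrightarrow> one_sided_tame (language_shift \<L>))"
  using coding_shift_backward_tame[OF assms(1)] forward_nontame_imp_language_nontame[OF assms]
    language_nontame_imp_forward_nontame[OF assms(1,3)] by blast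

end
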